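(* Let $\{q_n\}_{n\ge 1}$ and $\{q'_n\}_{n\ge 1}$ be sequences of positive reals such that $\lim_{n\to\infty} n(1-q_n)=\lim_{n\to\infty} n(1-q'_n)=\beta$ with $\beta\in\mathbb{R}$, $\beta\neq 0$. Let $\rho(x,y)=\int_0^1 u(x,t,\beta)\,u(t,y,\beta)\,dt$ for $x,y\in[0,1]$, and let $$\bar J=\sup_{\phi\in B^1_{\nearrow}}\int_0^1\sqrt{\dot\phi(x)\,\rho(x,\phi(x))}\,dx .$$ Then $$\bar J=\sqrt{\frac{\beta}{6\sinh(\beta/2)}}\cdot\int_0^1\sqrt{\cosh(\beta/2)+2\cosh\big(\beta[2x-1]/2\big)}\,dx.$$
   Context: For $x,y\in[0,1]$ and $\beta\ne0$, $$u(x,y,\beta)=\frac{(\beta/2)\sinh(\beta/2)}{\left(e^{\beta/4}\cosh(\beta[x-y]/2)-e^{-\beta/4}\cosh(\beta[x+y-1]/2)\right)^2}.$$ $B^1_{\nearrow}$ denotes the set of nondecreasing functions $\phi:[0,1]\to[0,1]$ with $\phi(0)=0$, $\phi(1)=1$ that have a bounded and continuous first order derivative $\dot\phi$. The constant $\bar J$ is the one for which $\mathrm{LCS}(\pi,\tau)/\sqrt n\to 2\bar J$ in probability when $\pi\sim\mu_{n,q_n}$ and $\tau\sim\mu_{n,q'_n}$ are independent; here $\mu_{n,q}$ is the Mallows measure on $S_n$, $\mu_{n,q}(\pi)\propto q^{l(\pi)}$ with $l(\pi)$ the number of inversions, and $\mathrm{LCS}$ is the length of the longest common subsequence. The identity above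 concerns only the analytically defined quantity $\bar J$. *)

theory Defs
  imports "HOL-Analysis.Analysis"
begin

text \<open>The limiting density of the empirical measure of a Mallows permutation.\<close>

definition u :: "real \<Rightarrow> real \<Rightarrow> real \<Rightarrow> real" where
  "u x y \<beta> = (\<beta> / 2) * sinh (\<beta> / 2) /
     (exp (\<beta> / 4) * cosh (\<beta> * (x - y) / 2) - exp (- \<beta> / 4) * cosh (\<beta> * (x + y - 1) / 2))\<^sup>2"

definition rho :: "real \<Rightarrow> real \<Rightarrow> real \<Rightarrow> real" where
  "rho \<beta> x y = integral {0..1} (\<lambda>t. u x t \<beta> * u t y \<beta>)"

text \<open>Functions on \<open>[0,1]\<close> are represented by total functions whose values outside \<open>[0,1]\<close>
  are irrelevant; accordingly the derivative is taken within \<open>[0,1]\<close>, hence one-sided at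
  the end points.\<close>

definition unit_deriv :: "(real \<Rightarrow> real) \<Rightarrow> real \<Rightarrow> real" where
  "unit_deriv \<phi> x = vector_derivative \<phi> (at x within {0..1})"

definition B1_up :: "(real \<Rightarrow> real) set" where
  "B1_up = {\<phi>. \<phi> \<in> {0..1} \<rightarrow> {0..1} \<and> mono_on {0..1} \<phi> \<and> \<phi> 0 = 0 \<and> \<phi> 1 = 1 \<and>
     \<phi> differentiable_on {0..1} \<and>
     bounded (unit_deriv \<phi> ` {0..1}) \<and> continuous_on {0..1} (unit_deriv \<phi>)}"

text \<open>The supremum is taken in the extended reals, so that its finiteness is not presupposed.\<close>

definition J_bar :: "real \<Rightarrow> ereal" where
  "J_bar \<beta> = (SUP \<phi>\<in>B1_up.
     ereal (integral {0..1} (\<lambda>x. sqrt (unit_deriv \<phi> x * rho \<beta> x (\<phi> x)))))"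

end

theory Submission
  imports Defs
begin

text \<open>By the symmetry of \<open>u\<close> and the Cauchy-Schwarz inequality,
  \<open>rho x y \<le> g x * g y\<close> where \<open>g x = sqrt (rho x x)\<close>. The AM-GM inequality then bounds the
  integrand \<open>sqrt (\<phi>' x * rho x (\<phi> x))\<close> by \<open>(g x + \<phi>' x * g (\<phi> x)) / 2\<close>, whose integral is that
  of \<open>g\<close> by substitution. The identity function attains this bound, so only
  \<open>rho x x\<close> needs to be computed.\<close>

section \<open>The density \<open>u\<close> and the diagonal of \<open>rho\<close>\<close>

lemma u_commute: "u x y \<beta> = u y x \<beta>"
proof -
  have "cosh (\<beta> * (x - y) / 2) = cosh (\<beta> * (y - x) / 2)"
    by (metis cosh_minus minus_diff_eq minus_divide_left mult_minus_right)
  then show ?thesis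
    unfolding u_def by (simp only: add.commute)
qed

text \<open>With the factor \<open>\<beta>\<close> both signs of \<open>\<beta>\<close> are treated
  alike: the expression is \<open>a * exp (\<beta> * t) + b\<close> with \<open>a\<close> and
  \<open>b\<close> nonnegative and not both zero. It shows that the denominator in the exponential
  form of \<open>u\<close> below never vanishes on the unit square.\<close>

lemma exp_denominator_pos:
  fixes \<beta> x t :: real
  assumes "\<beta> \<noteq> 0" "x \<in> {0..1}" "t \<in> {0..1}"
  shows "\<beta> * ((1 - exp (\<beta> * x) / exp \<beta>) * exp (\<beta> * t) + (exp (\<beta> * x) - 1)) > 0"
proof -
  define a b where "a = \<beta> * (1 - exp (\<beta> * x) / exp \<beta>)" and "b = \<beta> * (exp (\<beta> * x) - 1)"
  have pos: "\<beta> * (exp z - 1) > 0" if "\<beta> * z > 0" for z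
    using that by (auto simp: zero_less_mult_iff)
  have "a \<ge> 0"
  proof (cases "\<beta> > 0")
    case True
    then have "\<beta> * x \<le> \<beta>" using assms by auto
    then show ?thesis using True by (auto simp: a_def)
  next
    case False
    then have "\<beta> * x \<ge> \<beta>" using assms
      by (metis atLeastAtMost_iff less_eq_real_def linorder_not_le mult.right_neutral mult_left_mono_neg)
    then show ?thesis using False by (auto simp: a_def zero_le_mult_iff)
  qed
  moreover have "b \<ge> 0"
    using assms by (auto simp: b_def zero_le_mult_iff mult_le_0_iff)
  moreover have "a + b > 0"
  proof -
    have "a + b = \<beta> * (exp \<beta> - 1) * exp (\<beta> * x) / exp \<beta>"
      by (simp add: a_def b_def field_simps)
    then show ?thesis
      using pos[of \<beta>] assms(1) not_real_square_gt_zero[of \<beta>] by (metis divide_pos_pos exp_gt_zero mult_pos_pos)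
  qed
  ultimately have "a * exp (\<beta> * t) + b > 0"
    by (metis add.commute add_nonneg_pos add.right_neutral exp_gt_zero less_eq_real_def mult_pos_pos mult_zero_left)
  then show ?thesis
    by (simp add: a_def b_def algebra_simps)
qed

text \<open>For fixed \<open>x\<close> the denominator is the square of an affine function of
  \<open>exp (\<beta> * t)\<close>, so \<open>u x\<close> is the derivative of a Moebius function of
  \<open>exp (\<beta> * t)\<close> and can be integrated explicitly.\<close>

lemma u_exp_form:
  "u x t \<beta> = \<beta> * (1 - 1 / exp \<beta>) * exp (\<beta> * x) * exp (\<beta> * t) /
     ((1 - exp (\<beta> * x) / exp \<beta>) * exp (\<beta> * t) + (exp (\<beta> * x) - 1))\<^sup>2"
proof -
  \<comment> \<open>These fractional exponents make every exponential and hyperbolic term of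
    \<open>u\<close> a rational function of \<open>p\<close>, \<open>s\<close> and
    \<open>r\<close>.\<close>
  define p s r where "p = exp (\<beta> / 4)" and "s = exp (\<beta> * x / 2)" and "r = exp (\<beta> * t / 2)"
  have pos: "p > 0" "s > 0" "r > 0" by (simp_all add: p_def s_def r_def)
  have E: "exp \<beta> = p ^ 4" "exp (\<beta> * x) = s\<^sup>2" "exp (\<beta> * t) = r\<^sup>2" "exp (\<beta> / 2) = p\<^sup>2"
    "exp (- \<beta> / 4) = 1 / p"
    by (simp_all add: p_def s_def r_def exp_minus inverse_eq_divide flip: exp_of_nat_mult)
  have S: "sinh (\<beta> / 2) = (p\<^sup>2 - 1 / p\<^sup>2) / 2"
    by (simp add: sinh_field_def exp_minus E field_simps)
  have C1: "cosh (\<beta> * (x - t) / 2) = (s / r + r / s) / 2"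
    by (simp add: cosh_field_def s_def r_def field_simps flip: exp_diff)
  have "\<beta> * (x + t - 1) / 2 = \<beta> * x / 2 + \<beta> * t / 2 - \<beta> / 2"
    by (simp add: field_simps)
  then have C2: "cosh (\<beta> * (x + t - 1) / 2) = (s * r / p\<^sup>2 + p\<^sup>2 / (s * r)) / 2"
    by (simp only: cosh_field_def exp_minus exp_diff exp_add E(4) s_def[symmetric] r_def[symmetric])
      (simp add: field_simps)
  define L where "L = (1 - s\<^sup>2 / p ^ 4) * r\<^sup>2 + (s\<^sup>2 - 1)"
  \<comment> \<open>Both terms of the denominator of \<open>u\<close> are written with the common
    factor \<open>p / (2 * s * r)\<close>; what remains in their difference is
    \<open>L\<close>.\<close>
  have "p * ((s / r + r / s) / 2) = p * (s\<^sup>2 + r\<^sup>2) / (2 * s * r)"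
    using pos by (simp add: field_simps power2_eq_square)
  moreover have "1 / p * ((s * r / p\<^sup>2 + p\<^sup>2 / (s * r)) / 2) = p * (s\<^sup>2 * r\<^sup>2 / p ^ 4 + 1) / (2 * s * r)"
    using pos by (simp add: divide_simps) (simp add: algebra_simps power2_eq_square power4_eq_xxxx)
  ultimately have D: "p * ((s / r + r / s) / 2) - 1 / p * ((s * r / p\<^sup>2 + p\<^sup>2 / (s * r)) / 2) = p * L / (2 * s * r)"
    by (simp only: diff_divide_distrib[symmetric]) (simp add: L_def algebra_simps)
  have "u x t \<beta> = (\<beta> / 2) * ((p\<^sup>2 - 1 / p\<^sup>2) / 2) / (p * L / (2 * s * r))\<^sup>2"
    unfolding u_def C1 C2 S E p_def[symmetric] D ..
  also have "\<dots> = \<beta> * ((p\<^sup>2 - 1 / p\<^sup>2) / p\<^sup>2) * s\<^sup>2 * r\<^sup>2 / L\<^sup>2"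
    by (simp add: power_divide power_mult_distrib)
  also have "(p\<^sup>2 - 1 / p\<^sup>2) / p\<^sup>2 = 1 - 1 / p ^ 4"
    using pos by (simp add: field_simps power2_eq_square power4_eq_xxxx)
  finally show ?thesis
    unfolding L_def E .
qed

lemma continuous_on_u:
  assumes "\<beta> \<noteq> 0" "x \<in> {0..1}"
  shows "continuous_on {0..1} (\<lambda>t. u x t \<beta>)"
  unfolding u_exp_form
  by (intro continuous_intros) (use exp_denominator_pos[OF assms] in fastforce)

text \<open>By symmetry of \<open>u\<close> the integrand is the square of
  \<open>u x t \<beta>\<close>. Taking a primitive of one factor as the new variable turns the
  integral into that of a quadratic polynomial over the unit interval.\<close>

lemma rho_diagonal:
  assumes "\<beta> \<noteq> 0" "x \<in> {0..1}"
  shows "rho \<beta> x x = \<beta> / (6 * sinh (\<beta> / 2)) * (cosh (\<beta> / 2) + 2 * cosh (\<beta> * (2 * x - 1) / 2))"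
proof -
  define s E where "s = exp (\<beta> * x)" and "E = exp \<beta>"
  define A M where "A = 1 - s / E" and "M = s * (1 - 1 / E)"
  \<comment> \<open>The derivative of \<open>v\<close>, a Moebius function of \<open>exp (\<beta> * t)\<close>, is \<open>\<lambda>t. u x t \<beta>\<close>;
    in terms of \<open>v\<close> the other factor of the integrand of \<open>rho \<beta> x x\<close> is a polynomial.\<close>
  define L v where "L t = A * exp (\<beta> * t) + (s - 1)" and "v t = (exp (\<beta> * t) - 1) / L t" for t
  have pos: "s > 0" "E > 0" and E1: "E \<noteq> 1"
    using assms by (auto simp: s_def E_def)
  then have M0: "M \<noteq> 0" by (auto simp: M_def)
  have AM: "s - 1 = M - A" using pos by (simp add: A_def M_def field_simps)
  have L0: "L t \<noteq> 0" if "t \<in> {0..1}" for t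
    using exp_denominator_pos[OF assms that] unfolding L_def A_def s_def E_def by auto
  have dv: "(v has_real_derivative \<beta> * exp (\<beta> * t) * M / (L t)\<^sup>2) (at t within {0..1})"
    if "t \<in> {0..1}" for t
    unfolding v_def L_def using L0[OF that]
    by (auto intro!: derivative_eq_intros simp: L_def AM power2_eq_square algebra_simps)
  \<comment> \<open>One has \<open>u x t \<beta> = \<beta> * M * (exp (\<beta> * t) / L t) * (1 / L
    t)\<close>, where \<open>1 / L t = (1 - A * v t) / M\<close> and
    \<open>exp (\<beta> * t) / L t = v t + 1 / L t\<close>. \<open>P\<close> is the antiderivative
    of the resulting polynomial in \<open>v t\<close> that vanishes at 0.\<close>
  define P where "P z = \<beta> * (z\<^sup>2 / 2 - A * z ^ 3 / 3 + (z - A * z\<^sup>2 + A\<^sup>2 * z ^ 3 / 3) / M)" for z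
  have dP: "(P has_real_derivative \<beta> * ((z + (1 - A * z) / M) * (1 - A * z))) (at z)" for z
    unfolding P_def using M0
    by (auto intro!: derivative_eq_intros simp: field_simps power2_eq_square)
  have uu: "u x t \<beta> * u t x \<beta> =
      \<beta> * ((v t + (1 - A * v t) / M) * (1 - A * v t)) * (\<beta> * exp (\<beta> * t) * M / (L t)\<^sup>2)"
    if "t \<in> {0..1}" for t
  proof -
    have inv: "1 - A * v t = M / L t"
      using L0[OF that] by (simp add: v_def AM L_def field_simps)
    have vt: "v t + M / L t / M = exp (\<beta> * t) / L t"
      using L0[OF that] M0 by (simp add: v_def field_simps)
    have u: "u x t \<beta> = \<beta> * M * exp (\<beta> * t) / (L t)\<^sup>2"
      unfolding u_exp_form M_def L_def A_def s_def E_def by (simp add: mult_ac)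
    show ?thesis
      unfolding inv vt u u_commute[of t x] by (simp add: power2_eq_square)
  qed
  have "((\<lambda>t. u x t \<beta> * u t x \<beta>) has_integral P (v 1) - P (v 0)) {0..1}"
  proof (rule fundamental_theorem_of_calculus)
    fix t :: real assume t: "t \<in> {0..1}"
    show "((\<lambda>t. P (v t)) has_vector_derivative u x t \<beta> * u t x \<beta>) (at t within {0..1})"
      using DERIV_chain2[OF dP dv[OF t]] uu[OF t]
      by (simp add: has_real_derivative_iff_has_vector_derivative)
  qed simp
  moreover have "v 0 = 0" by (simp add: v_def)
  moreover have "v 1 = 1"
  proof -
    have "L 1 = E - 1" using pos by (simp add: L_def A_def E_def[symmetric] field_simps)
    then show ?thesis using E1 by (simp add: v_def E_def)
  qed
  ultimately have "rho \<beta> x x = P 1"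
    unfolding rho_def by (simp add: integral_unique P_def)
  also have "\<dots> = \<beta> * (1 + E + 2 * (s + E / s)) / (6 * (E - 1))"
  proof -
    have "E - 1 \<noteq> 0" using E1 by simp
    moreover have "M = s * (E - 1) / E" "A = (E - s) / E"
      using pos by (auto simp: M_def A_def field_simps)
    ultimately show ?thesis
      unfolding P_def using pos
      by (simp only:) (simp add: divide_simps, simp add: algebra_simps power2_eq_square)
  qed
  also have "\<dots> = \<beta> / (6 * sinh (\<beta> / 2)) * (cosh (\<beta> / 2) + 2 * cosh (\<beta> * (2 * x - 1) / 2))"
  proof -
    \<comment> \<open>Dividing numerator and denominator by \<open>exp (\<beta> / 2)\<close> makes
      the exponents symmetric, which produces the hyperbolic functions.\<close>
    define p where "p = exp (\<beta> / 2)"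
    have p: "p > 0" "E = p\<^sup>2" by (simp_all add: p_def E_def flip: exp_of_nat_mult)
    have "\<beta> * (2 * x - 1) / 2 = \<beta> * x - \<beta> / 2" by (simp add: field_simps)
    then have C: "cosh (\<beta> * (2 * x - 1) / 2) = (s / p + p / s) / 2"
      by (simp only: cosh_field_def exp_diff exp_minus s_def[symmetric] p_def[symmetric])
        (simp add: field_simps)
    have H: "sinh (\<beta> / 2) = (p - 1 / p) / 2" "cosh (\<beta> / 2) = (p + 1 / p) / 2"
      by (simp_all add: sinh_field_def cosh_field_def exp_minus p_def field_simps)
    have "p\<^sup>2 - 1 \<noteq> 0" using E1 p by simp
    then show ?thesis unfolding C H p(2) using p(1) pos
      by (simp add: divide_simps) (simp add: algebra_simps power2_eq_square)
  qed
  finally show ?thesis .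
qed

section \<open>Positivity on the diagonal and the Cauchy-Schwarz bound\<close>

lemma div_sinh_pos:
  fixes \<beta> :: real
  assumes "\<beta> \<noteq> 0"
  shows "\<beta> / (6 * sinh (\<beta> / 2)) > 0"
  using assms by (auto simp: zero_less_divide_iff zero_less_mult_iff)

lemma cosh_sum_pos: "cosh a + 2 * cosh b > (0::real)"
  by (simp add: add_pos_pos)

lemma rho_diagonal_pos:
  assumes "\<beta> \<noteq> 0" "x \<in> {0..1}"
  shows "rho \<beta> x x > 0"
  unfolding rho_diagonal[OF assms] by (intro mult_pos_pos div_sinh_pos assms cosh_sum_pos)

text \<open>Since \<open>u\<close> is symmetric, \<open>rho \<beta> x y\<close> is the L2 inner
  product of \<open>u x\<close> and \<open>u y\<close>, and \<open>a\<close>, \<open>b\<close> are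
  their norms. Both are positive, so the square of
  \<open>b * u x t \<beta> - a * u y t \<beta>\<close> may be divided by \<open>a * b\<close> and
  integrated.\<close>

lemma rho_Cauchy_Schwarz:
  assumes "\<beta> \<noteq> 0" "x \<in> {0..1}" "y \<in> {0..1}"
  shows "rho \<beta> x y \<le> sqrt (rho \<beta> x x) * sqrt (rho \<beta> y y)"
proof -
  define a b where "a = sqrt (rho \<beta> x x)" and "b = sqrt (rho \<beta> y y)"
  have ab: "a > 0" "b > 0" using rho_diagonal_pos assms by (auto simp: a_def b_def)
  have sq: "rho \<beta> x x = a\<^sup>2" "rho \<beta> y y = b\<^sup>2"
    using rho_diagonal_pos[OF assms(1)] assms(2,3) by (simp_all add: a_def b_def less_imp_le)
  have int: "((\<lambda>t. u z t \<beta> * u t w \<beta>) has_integral rho \<beta> z w) {0..1}"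
    if "z \<in> {0..1}" "w \<in> {0..1}" for z w
    unfolding rho_def u_commute[of _ w]
    by (intro integrable_integral integrable_continuous_interval continuous_intros continuous_on_u that assms(1))
  \<comment> \<open>The weights are chosen so that the right-hand side equals
    \<open>2 * a * b\<close>.\<close>
  have "2 * rho \<beta> x y \<le> (b / a) * a\<^sup>2 + (a / b) * b\<^sup>2"
  proof (rule has_integral_le)
    show "((\<lambda>t. 2 * (u x t \<beta> * u t y \<beta>)) has_integral 2 * rho \<beta> x y) {0..1}"
      by (intro has_integral_mult_right int assms)
    show "((\<lambda>t. (b / a) * (u x t \<beta> * u t x \<beta>) + (a / b) * (u y t \<beta> * u t y \<beta>))
        has_integral (b / a) * a\<^sup>2 + (a / b) * b\<^sup>2) {0..1}"
      unfolding sq[symmetric] by (intro has_integral_add has_integral_mult_right int assms)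
    fix t :: real
    have "0 \<le> (b * u x t \<beta> - a * u y t \<beta>)\<^sup>2 / (a * b)" using ab by simp
    also have "\<dots> = (b / a) * (u x t \<beta> * u x t \<beta>) + (a / b) * (u y t \<beta> * u y t \<beta>) - 2 * (u x t \<beta> * u y t \<beta>)"
      using ab by (simp add: field_simps power2_eq_square)
    finally show "2 * (u x t \<beta> * u t y \<beta>) \<le> (b / a) * (u x t \<beta> * u t x \<beta>) + (a / b) * (u y t \<beta> * u t y \<beta>)"
      by (simp add: u_commute[of t])
  qed
  then have "rho \<beta> x y \<le> a * b"
    using ab by (simp add: power2_eq_square mult_ac)
  then show ?thesis by (simp add: a_def b_def)
qed

section \<open>The class \<open>B1_up\<close> and the supremum over it\<close>

lemma B1_up_has_derivative:
  assumes "\<phi> \<in> B1_up" "x \<in> {0..1}"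
  shows "(\<phi> has_real_derivative unit_deriv \<phi> x) (at x within {0..1})"
  using assms unfolding B1_up_def unit_deriv_def has_real_derivative_iff_has_vector_derivative
  by (auto simp: differentiable_on_def vector_derivative_works)

text \<open>At interior points the derivative within the unit interval is the ordinary one, and
  monotonicity fixes its sign. The end points form a null set and do not affect the integrals
  compared later.\<close>

lemma B1_up_deriv_nonneg:
  assumes "\<phi> \<in> B1_up" "x \<in> {0<..<1}"
  shows "unit_deriv \<phi> x \<ge> 0"
proof (rule mono_on_imp_deriv_nonneg)
  show "mono_on {0..1} \<phi>" using assms by (simp add: B1_up_def)
  show "x \<in> interior {0..1}" using assms by simp
  show "(\<phi> has_real_derivative unit_deriv \<phi> x) (at x)"
    using B1_up_has_derivative[OF assms(1), of x] assms(2) by (simp add: at_within_Icc_at)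
qed

lemma unit_deriv_id: "x \<in> {0..1} \<Longrightarrow> unit_deriv (\<lambda>x. x) x = 1"
  unfolding unit_deriv_def by (rule vector_derivative_at_within_ivl) (auto intro: has_vector_derivative_id)

lemma id_in_B1_up: "(\<lambda>x. x) \<in> B1_up"
proof -
  have "continuous_on {0..1} (unit_deriv (\<lambda>x. x)) \<longleftrightarrow> continuous_on {0..1} (\<lambda>_::real. 1::real)"
    by (rule continuous_on_cong[OF refl unit_deriv_id])
  then have "continuous_on {0..1} (unit_deriv (\<lambda>x. x))"
    by simp
  moreover have "unit_deriv (\<lambda>x. x) ` {0..1} \<subseteq> {1}" by (auto simp: unit_deriv_id)
  then have "bounded (unit_deriv (\<lambda>x. x) ` {0..1})"
    by (rule bounded_subset[rotated]) simp
  ultimately show ?thesis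
    by (auto simp: B1_up_def mono_on_def)
qed

lemma J_functional_le:
  assumes "\<beta> \<noteq> 0" "\<phi> \<in> B1_up"
  shows "integral {0..1} (\<lambda>x. sqrt (unit_deriv \<phi> x * rho \<beta> x (\<phi> x)))
    \<le> integral {0..1} (\<lambda>x. sqrt (rho \<beta> x x))"
    (is "integral _ ?f \<le> integral _ ?g")
proof -
  have \<phi>: "\<phi> x \<in> {0..1}" if "x \<in> {0..1}" for x
    using assms that by (auto simp: B1_up_def)
  have \<phi>01: "\<phi> 0 = 0" "\<phi> 1 = 1" using assms by (auto simp: B1_up_def)
  have cont: "continuous_on {0..1} ?g"
    by (subst continuous_on_cong[OF refl, of _ _ "\<lambda>x. sqrt (\<beta> / (6 * sinh (\<beta> / 2)) *
          (cosh (\<beta> / 2) + 2 * cosh (\<beta> * (2 * x - 1) / 2)))"])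
       (simp_all only: rho_diagonal[OF assms(1)], use assms(1) in \<open>auto intro!: continuous_intros\<close>)
  have g: "(?g has_integral integral {0..1} ?g) {0..1}"
    by (intro integrable_integral integrable_continuous_interval cont)
  \<comment> \<open>As \<open>\<phi>\<close> fixes 0 and 1, the change of variables leads back to
    the integral of the same function over the same interval.\<close>
  have subst: "((\<lambda>x. unit_deriv \<phi> x *\<^sub>R ?g (\<phi> x)) has_integral integral {\<phi> 0..\<phi> 1} ?g) {0..1}"
    by (rule has_integral_substitution[where c = 0 and d = 1])
       (use \<phi> \<phi>01 cont B1_up_has_derivative[OF assms(2)] in auto)
  have bound: "((\<lambda>x. (?g x + unit_deriv \<phi> x * ?g (\<phi> x)) / 2) has_integral integral {0..1} ?g) {0..1}"
    using has_integral_divide[OF has_integral_add[OF g subst], of 2] by (simp add: \<phi>01)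
  show ?thesis
  \<comment> \<open>\<open>integral\<close> is 0 on functions that are not integrable; in that case
    it is enough that the right-hand side is nonnegative.\<close>
  proof (cases "?f integrable_on {0..1}")
    case True
    show ?thesis
    proof (rule has_integral_le)
      show "(?f has_integral integral {0..1} ?f) {0<..<1}"
        using integrable_integral[OF True] by (simp only: has_integral_Icc_iff_Ioo)
      show "((\<lambda>x. (?g x + unit_deriv \<phi> x * ?g (\<phi> x)) / 2) has_integral integral {0..1} ?g) {0<..<1}"
        using bound by (simp only: has_integral_Icc_iff_Ioo)
      fix x :: real assume x: "x \<in> {0<..<1}"
      then have x': "x \<in> {0..1}" by auto
      define d where "d = unit_deriv \<phi> x"
      have d: "d \<ge> 0" using B1_up_deriv_nonneg[OF assms(2) x] by (simp add: d_def)
      have g0: "?g x \<ge> 0" "?g (\<phi> x) \<ge> 0"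
        using rho_diagonal_pos[OF assms(1)] x' \<phi>[OF x'] by (auto intro: less_imp_le)
      have "?f x \<le> sqrt (?g x * (d * ?g (\<phi> x)))"
        using mult_left_mono[OF rho_Cauchy_Schwarz[OF assms(1) x' \<phi>[OF x']] d]
        by (simp add: d_def mult_ac)
      also have "\<dots> \<le> (?g x + d * ?g (\<phi> x)) / 2"
        by (rule arith_geo_mean_sqrt) (use g0 d in auto)
      finally show "?f x \<le> (?g x + unit_deriv \<phi> x * ?g (\<phi> x)) / 2" by (simp add: d_def)
    qed
  next
    case False
    moreover have "integral {0..1} ?g \<ge> 0"
      using rho_diagonal_pos[OF assms(1)] by (intro integral_nonneg has_integral_integrable[OF g]) (auto intro: less_imp_le)
    ultimately show ?thesis by (simp add: not_integrable_integral)
  qed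
qed

lemma J_bar_eq:
  assumes "\<beta> \<noteq> 0"
  shows "J_bar \<beta> = ereal (integral {0..1} (\<lambda>x. sqrt (rho \<beta> x x)))"
  unfolding J_bar_def
proof (rule antisym)
  show "(SUP \<phi>\<in>B1_up. ereal (integral {0..1} (\<lambda>x. sqrt (unit_deriv \<phi> x * rho \<beta> x (\<phi> x)))))
      \<le> ereal (integral {0..1} (\<lambda>x. sqrt (rho \<beta> x x)))"
    using J_functional_le[OF assms] by (auto intro!: SUP_least)
  \<comment> \<open>The identity has derivative 1 on the whole interval and stays on the diagonal,
    so the functional takes the value of the upper bound there.\<close>
  have "integral {0..1} (\<lambda>x. sqrt (rho \<beta> x x)) =
      integral {0..1} (\<lambda>x. sqrt (unit_deriv (\<lambda>x. x) x * rho \<beta> x x))"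
    by (rule integral_cong) (simp add: unit_deriv_id)
  then show "ereal (integral {0..1} (\<lambda>x. sqrt (rho \<beta> x x)))
      \<le> (SUP \<phi>\<in>B1_up. ereal (integral {0..1} (\<lambda>x. sqrt (unit_deriv \<phi> x * rho \<beta> x (\<phi> x)))))"
    by (intro SUP_upper2[OF id_in_B1_up]) simp
qed

theorem corollary1p5:
  fixes q q' :: "nat \<Rightarrow> real" and \<beta> :: real
  assumes "\<And>n. n \<ge> 1 \<Longrightarrow> q n > 0"
    and "\<And>n. n \<ge> 1 \<Longrightarrow> q' n > 0"
    and "(\<lambda>n. real n * (1 - q n)) \<longlonglongrightarrow> \<beta>"
    and "(\<lambda>n. real n * (1 - q' n)) \<longlonglongrightarrow> \<beta>"
    and "\<beta> \<noteq> 0"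
  shows "J_bar \<beta> = ereal (sqrt (\<beta> / (6 * sinh (\<beta> / 2))) *
    integral {0..1} (\<lambda>x. sqrt (cosh (\<beta> / 2) + 2 * cosh (\<beta> * (2 * x - 1) / 2))))"
proof -
  have "integral {0..1} (\<lambda>x. sqrt (rho \<beta> x x)) =
      integral {0..1} (\<lambda>x. sqrt (\<beta> / (6 * sinh (\<beta> / 2))) *
        sqrt (cosh (\<beta> / 2) + 2 * cosh (\<beta> * (2 * x - 1) / 2)))"
    by (intro integral_cong) (simp only: rho_diagonal[OF assms(5)] real_sqrt_mult)
  then show ?thesis
    by (simp add: J_bar_eq[OF assms(5)])
qed

end
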